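(* Consider any instance of the congestion game in which every resource uses the Rand policy, and let $x$ be any (mixed) Nash equilibrium of it. Then there exists a feasible solution of (SDP-RAND) with objective value at least $\frac12\,C(x)$, where $C$ is the social cost under Rand. This implies that the price of anarchy of the game is at most $2$, i.e. $C(x)\le 2\,C(x^* )$ for every Nash equilibrium $x$ and every pure assignment $x^*$.
   Context: Congestion model. $N$ is a finite set of players and $E$ a finite set of resources. Each player $j\in N$ has a weight $w_j\ge 0$, a nonempty strategy set $\mathcal S_j\subseteq 2^E$, and processing times $p_{ej}\in[0,\infty]$ $(e\in E)$, with $p_{ej}<\infty$ whenever $e$ belongs to some strategy $i\in\mathcal S_j$. The Smith ratio is $\delta_{ej}=p_{ej}/w_j$, read as $+\infty$ if $w_j=0$. An assignment is $x=(x_{ij})_{j\in N,i\in\mathcal S_j}$ with $x_{ij}\ge 0$ and $\sum_{i\in\mathcal S_j}x_{ij}=1$ for all $j$ ($x_{ij}$ is the probability that $j$ independently chooses $i$); it is pure if all $x_{ij}\in\{0,1\}$. Put $z_{ej}=\sum_{i\in\mathcal S_j:\,e\in i}x_{ij}$. Any term containing a factor $z_{ek}=0$ or a factor $w_k=0$ is read as $0$. Rand. Each resource orders its players randomly so that $j$ comes after $k$ with probability $\delta_{ej}/(\delta_{ej}+\delta_{ek})$ (read as $1$ if only $\delta_{ej}$ is infinite, as $0$ if only $\delta_{ek}$ is infinite, and as $\frac12$ if both are infinite or both are $0$). The (expected) cost of player $j$ is $$C_j(x)=\sum_{i\in\mathcal S_j}x_{ij}\sum_{e\in i}\Big(p_{ej}+\sum_{k\ne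 j}\frac{\delta_{ej}}{\delta_{ej}+\delta_{ek}}\,p_{ek}z_{ek}\Big),$$ and the social cost is $C(x)=\sum_{j\in N}w_jC_j(x)$. Nash equilibrium. $x$ is a (mixed) Nash equilibrium if $C_j(x)\le C_j(x_{-j},i)$ for all $j\in N$, $i\in\mathcal S_j$, where $(x_{-j},i)$ is obtained from $x$ by letting $j$ choose $i$ with probability $1$. The price of anarchy is the worst ratio between $C(x)$ for a Nash equilibrium $x$ and the minimum of $C$ over pure assignments, both under the Rand policy. (SDP-RAND): the variables are reals $y_j$ $(j\in N)$ and vectors $v_0, v_{ij}\in\mathbb R^d$ $(j\in N,i\in\mathcal S_j)$ for some $d\in\mathbb N$, with the standard inner product. Maximize $\sum_{j\in N}y_j-\frac12\|v_0\|^2$ subject to $y_j\le\sum_{e\in i}w_jp_{ej}-\frac12\|v_{ij}\|^2+\langle v_0,v_{ij}\rangle$ for all $j\in N,i\in\mathcal S_j$; and $\langle v_{ij},v_{i'k}\rangle\le 2\sum_{e\in i\cap i'}w_jw_k\frac{\delta_{ej}\delta_{ek}}{\delta_{ej}+\delta_{ek}}$ for all $(i,j)\ne(i',k)$ with $j,k\in N$, $i\in\mathcal S_j$, $i'\in\mathcal S_k$ (with $\frac{rs}{r+s}:=0$ when $r=s=0$). *)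

theory Defs
  imports
    "HOL-Library.Extended_Nonnegative_Real"
    "Jordan_Normal_Form.Matrix"
begin

record ('n, 'e) congestion_game =
  players :: "'n set"
  resources :: "'e set"
  weight :: "'n \<Rightarrow> real"
  strategies :: "'n \<Rightarrow> 'e set set"
  ptime :: "'e \<Rightarrow> 'n \<Rightarrow> ennreal"

definition is_instance :: "('n, 'e) congestion_game \<Rightarrow> bool" where
  "is_instance G \<longleftrightarrow>
     finite (players G) \<and> finite (resources G) \<and>
     (\<forall>j\<in>players G.
        weight G j \<ge> 0 \<and>
        strategies G j \<noteq> {} \<and>
        strategies G j \<subseteq> Pow (resources G) \<and>
        (\<forall>i\<in>strategies G j. \<forall>e\<in>i. ptime G e j < \<infinity>))"

text \<open>The weight-zero case is explicit because in \<^typ>\<open>ennreal\<close> one has \<open>0 / 0 = 0\<close>,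
  whereas the Smith ratio of a player of weight zero is infinite even if the processing time is zero.\<close>

definition smith :: "('n, 'e) congestion_game \<Rightarrow> 'e \<Rightarrow> 'n \<Rightarrow> ennreal" where
  "smith G e j = (if weight G j = 0 then \<infinity> else ptime G e j / ennreal (weight G j))"

text \<open>An assignment \<open>x\<close> gives player \<open>j\<close> the strategy \<open>i\<close> with probability \<open>x j i\<close>; only the
  values with \<open>j\<close> a player and \<open>i\<close> a strategy of \<open>j\<close> are ever used.\<close>

definition assignment :: "('n, 'e) congestion_game \<Rightarrow> ('n \<Rightarrow> 'e set \<Rightarrow> real) \<Rightarrow> bool" where
  "assignment G x \<longleftrightarrow>
     (\<forall>j\<in>players G. (\<forall>i\<in>strategies G j. x j i \<ge> 0) \<and> (\<Sum>i\<in>strategies G j. x j i) = 1)"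

definition pure_assignment :: "('n, 'e) congestion_game \<Rightarrow> ('n \<Rightarrow> 'e set \<Rightarrow> real) \<Rightarrow> bool" where
  "pure_assignment G x \<longleftrightarrow>
     assignment G x \<and> (\<forall>j\<in>players G. \<forall>i\<in>strategies G j. x j i \<in> {0, 1})"

definition usage :: "('n, 'e) congestion_game \<Rightarrow> ('n \<Rightarrow> 'e set \<Rightarrow> real) \<Rightarrow> 'e \<Rightarrow> 'n \<Rightarrow> real" where
  "usage G x e j = (\<Sum>i\<in>{i\<in>strategies G j. e \<in> i}. x j i)"

text \<open>\<open>rand_after a b\<close> is the probability that the Rand policy puts a player with Smith ratio \<open>a\<close>
  after a player with Smith ratio \<open>b\<close>.\<close>

definition rand_after :: "ennreal \<Rightarrow> ennreal \<Rightarrow> real" where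
  "rand_after a b =
     (if (a = \<infinity> \<and> b = \<infinity>) \<or> (a = 0 \<and> b = 0) then 1/2
      else if a = \<infinity> then 1
      else if b = \<infinity> then 0
      else enn2real a / (enn2real a + enn2real b))"

text \<open>Costs are finite, hence real-valued: \<open>ptime G e j\<close> is finite for every resource \<open>e\<close> in a
  strategy of \<open>j\<close>, and where \<open>ptime G e k\<close> is infinite, \<open>usage G x e k\<close> is an empty sum, so that
  the product below is \<open>0\<close>, as the convention for infinite processing times demands.\<close>

definition player_cost ::
  "('n, 'e) congestion_game \<Rightarrow> ('n \<Rightarrow> 'e set \<Rightarrow> real) \<Rightarrow> 'n \<Rightarrow> real" where
  "player_cost G x j =
     (\<Sum>i\<in>strategies G j. x j i *
        (\<Sum>e\<in>i. enn2real (ptime G e j) +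
           (\<Sum>k\<in>players G - {j}.
              rand_after (smith G e j) (smith G e k) * enn2real (ptime G e k) * usage G x e k)))"

definition social_cost :: "('n, 'e) congestion_game \<Rightarrow> ('n \<Rightarrow> 'e set \<Rightarrow> real) \<Rightarrow> real" where
  "social_cost G x = (\<Sum>j\<in>players G. weight G j * player_cost G x j)"

definition deviate ::
  "('n \<Rightarrow> 'e set \<Rightarrow> real) \<Rightarrow> 'n \<Rightarrow> 'e set \<Rightarrow> ('n \<Rightarrow> 'e set \<Rightarrow> real)" where
  "deviate x j i = x(j := (\<lambda>i'. if i' = i then 1 else 0))"

definition nash_equilibrium ::
  "('n, 'e) congestion_game \<Rightarrow> ('n \<Rightarrow> 'e set \<Rightarrow> real) \<Rightarrow> bool" where
  "nash_equilibrium G x \<longleftrightarrow>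
     assignment G x \<and>
     (\<forall>j\<in>players G. \<forall>i\<in>strategies G j. player_cost G x j \<le> player_cost G (deviate x j i) j)"

text \<open>The ratios are taken in \<^typ>\<open>ennreal\<close>: a positive equilibrium cost over an optimum of \<open>0\<close>
  counts as \<open>\<infinity>\<close>, and \<open>0 / 0\<close> as \<open>0\<close>. The infimum in the denominator is a minimum, since
  pure assignments take only finitely many values on the relevant arguments.\<close>

definition price_of_anarchy :: "('n, 'e) congestion_game \<Rightarrow> ennreal" where
  "price_of_anarchy G =
     (SUP x\<in>{x. nash_equilibrium G x}.
        ennreal (social_cost G x) / (INF x'\<in>{x'. pure_assignment G x'}. ennreal (social_cost G x')))"

text \<open>In the semidefinite program, \<open>v j i\<close> is the vector of player \<open>j\<close> and strategy \<open>i\<close>, and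
  squared norms are written as scalar products. The Smith ratios in the last constraint are finite
  unless one of the weights is \<open>0\<close>, in which case the term is \<open>0\<close>; and division by zero in the
  reals gives the value \<open>0\<close> required when both ratios vanish.\<close>

definition sdp_feasible ::
  "('n, 'e) congestion_game \<Rightarrow> nat \<Rightarrow> ('n \<Rightarrow> real) \<Rightarrow> real vec \<Rightarrow> ('n \<Rightarrow> 'e set \<Rightarrow> real vec) \<Rightarrow> bool"
  where
  "sdp_feasible G d y v0 v \<longleftrightarrow>
     v0 \<in> carrier_vec d \<and>
     (\<forall>j\<in>players G. \<forall>i\<in>strategies G j. v j i \<in> carrier_vec d) \<and>
     (\<forall>j\<in>players G. \<forall>i\<in>strategies G j.
        y j \<le> (\<Sum>e\<in>i. weight G j * enn2real (ptime G e j))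
               - (v j i \<bullet> v j i) / 2 + v0 \<bullet> v j i) \<and>
     (\<forall>j\<in>players G. \<forall>k\<in>players G. \<forall>i\<in>strategies G j. \<forall>i'\<in>strategies G k.
        (i, j) \<noteq> (i', k) \<longrightarrow>
        v j i \<bullet> v k i' \<le>
          2 * (\<Sum>e\<in>i \<inter> i'. weight G j * weight G k *
                 (enn2real (smith G e j) * enn2real (smith G e k) /
                  (enn2real (smith G e j) + enn2real (smith G e k)))))"

definition sdp_objective ::
  "('n, 'e) congestion_game \<Rightarrow> ('n \<Rightarrow> real) \<Rightarrow> real vec \<Rightarrow> real" where
  "sdp_objective G y v0 = (\<Sum>j\<in>players G. y j) - (v0 \<bullet> v0) / 2"

end

theory Submission
  imports Defs
begin

text \<open>The kernel \<open>r s / (r + s)\<close> on the nonnegative reals is positive semidefinite, so there are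
  vectors \<open>u\<^sub>i\<^sub>j\<close> whose scalar products are the interaction costs
  \<open>\<Sum>e\<in>i \<inter> i'. w\<^sub>j w\<^sub>k \<delta>\<^sub>e\<^sub>j \<delta>\<^sub>e\<^sub>k / (\<delta>\<^sub>e\<^sub>j + \<delta>\<^sub>e\<^sub>k)\<close>, with \<open>\<parallel>u\<^sub>i\<^sub>j\<parallel>\<^sup>2\<close> half the weighted processing time of \<open>i\<close>.
  With \<open>U = \<Sum> x\<^sub>i\<^sub>j u\<^sub>i\<^sub>j\<close>, the equilibrium condition gives
  \<open>w\<^sub>j C\<^sub>j(x) \<le> 2 \<parallel>u\<^sub>i\<^sub>j\<parallel>\<^sup>2 + \<langle>u\<^sub>i\<^sub>j, U\<rangle>\<close>, while \<open>\<parallel>U\<parallel>\<^sup>2 \<le> C(x)\<close>. Hence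
  \<open>v\<^sub>i\<^sub>j = (2/\<surd>3) u\<^sub>i\<^sub>j\<close>, \<open>v\<^sub>0 = (1/\<surd>3) U\<close>, \<open>y\<^sub>j = (2/3) w\<^sub>j C\<^sub>j(x)\<close> is feasible with value at least
  \<open>(2/3 - 1/6) C(x)\<close>. The bound on the price of anarchy is then weak duality: completing the
  square in \<open>v\<^sub>0\<close> bounds every feasible value by the cost of every pure assignment.\<close>

section \<open>Gram factorization of the Cauchy and parallel-sum kernels\<close>

text \<open>The first summand is the rank-one term split off by pivoting on c, whose diagonal entry
  is 1 / (2 c). After clearing denominators the identity is 2 c (a + b) + (a - c) (b - c) = (a + c)
  (b + c).\<close>

lemma cauchy_schur_complement:
  fixes a b c :: real
  assumes "a > 0" "b > 0" "c > 0"
  shows "sqrt (2 * c) / (a + c) * (sqrt (2 * c) / (b + c))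
           + (a - c) / (a + c) * ((b - c) / (b + c)) * (1 / (a + b)) = 1 / (a + b)"
proof -
  have "sqrt (2 * c) / (a + c) * (sqrt (2 * c) / (b + c)) = 2 * c / ((a + c) * (b + c))"
    using assms by (simp add: times_divide_times_eq)
  moreover have "2 * c / ((a + c) * (b + c)) + (a - c) / (a + c) * ((b - c) / (b + c)) * (1 / (a + b))
      = 1 / (a + b)"
  proof -
    have "a + c \<noteq> 0" "b + c \<noteq> 0" "a + b \<noteq> 0" using assms by auto
    then show ?thesis by (simp add: divide_simps) (simp add: algebra_simps)
  qed
  ultimately show ?thesis by (simp only:)
qed

text \<open>Eliminating one point \<open>c\<close> from the Cauchy matrix \<open>1 / (a + b)\<close> leaves the same matrix scaled
  on both sides by \<open>(a - c) / (a + c)\<close>, so a Cholesky factorization can be written down recursively.\<close>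

lemma cauchy_kernel_gram:
  fixes A :: "real set"
  assumes "finite A" "\<forall>a\<in>A. a > 0"
  shows "\<exists>n (\<phi> :: nat \<Rightarrow> real \<Rightarrow> real). \<forall>a\<in>A. \<forall>b\<in>A. (\<Sum>m<n. \<phi> m a * \<phi> m b) = 1 / (a + b)"
  using assms
proof (induction A rule: finite_induct)
  case empty
  show ?case by simp
next
  case (insert c A)
  then obtain n and \<phi> :: "nat \<Rightarrow> real \<Rightarrow> real"
    where IH: "\<And>a b. a \<in> A \<Longrightarrow> b \<in> A \<Longrightarrow> (\<Sum>m<n. \<phi> m a * \<phi> m b) = 1 / (a + b)"
    by auto
  define g where "g a = (a - c) / (a + c)" for a
  \<comment> \<open>Coordinate 0 carries the pivot's rank-one term; the old coordinates, rescaled by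
    \<open>g\<close>, carry the Schur complement.\<close>
  define \<psi> where
    "\<psi> m a = (case m of 0 \<Rightarrow> sqrt (2 * c) / (a + c) | Suc l \<Rightarrow> g a * \<phi> l a)" for m a
  have sum: "(\<Sum>m<Suc n. \<psi> m a * \<psi> m b) =
      sqrt (2 * c) / (a + c) * (sqrt (2 * c) / (b + c)) + g a * g b * (\<Sum>m<n. \<phi> m a * \<phi> m b)" for a b
    unfolding sum.lessThan_Suc_shift
    by (simp add: \<psi>_def sum_distrib_left algebra_simps)
  have "(\<Sum>m<Suc n. \<psi> m a * \<psi> m b) = 1 / (a + b)" if ab: "a \<in> insert c A" "b \<in> insert c A" for a b
  proof -
    have pos: "a > 0" "b > 0" "c > 0" using ab insert.prems by auto
    have "g a * g b * (\<Sum>m<n. \<phi> m a * \<phi> m b) = g a * g b * (1 / (a + b))"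
    \<comment> \<open>The induction hypothesis says nothing about \<open>\<phi>\<close> at the new
      point c, but there the factor \<open>g c = 0\<close> makes both sides vanish.\<close>
    proof (cases "a = c \<or> b = c")
      case True
      then show ?thesis by (auto simp: g_def)
    next
      case False
      then show ?thesis using ab IH by simp
    qed
    then show ?thesis
      unfolding sum using cauchy_schur_complement[OF pos] by (simp add: g_def)
  qed
  then show ?case by blast
qed

text \<open>Multiplying each Cauchy coordinate at a by a turns 1 / (a + b) into a b / (a + b). The
  point 0, excluded from the Cauchy kernel, then has only zero coordinates, in agreement with
  \<open>0 / 0 = 0\<close>.\<close>

lemma parallel_sum_kernel_gram:
  fixes A :: "real set"
  assumes "finite A" "\<forall>a\<in>A. a \<ge> 0"
  shows "\<exists>n (\<phi> :: nat \<Rightarrow> real \<Rightarrow> real). \<forall>a\<in>A. \<forall>b\<in>A. (\<Sum>m<n. \<phi> m a * \<phi> m b) = a * b / (a + b)"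
proof -
  have "finite (A - {0})" "\<forall>a\<in>A - {0}. a > 0"
    using assms by (auto simp: less_le)
  then obtain n and \<phi> :: "nat \<Rightarrow> real \<Rightarrow> real" where \<phi>:
    "\<And>a b. a \<in> A - {0} \<Longrightarrow> b \<in> A - {0} \<Longrightarrow> (\<Sum>m<n. \<phi> m a * \<phi> m b) = 1 / (a + b)"
    using cauchy_kernel_gram[of "A - {0}"] by blast
  have "(\<Sum>m<n. (a * \<phi> m a) * (b * \<phi> m b)) = a * b / (a + b)" if "a \<in> A" "b \<in> A" for a b
  proof -
    have "(\<Sum>m<n. (a * \<phi> m a) * (b * \<phi> m b)) = a * b * (\<Sum>m<n. \<phi> m a * \<phi> m b)"
      by (simp add: sum_distrib_left algebra_simps)
    then show ?thesis using \<phi>[of a b] that by (cases "a = 0 \<or> b = 0") auto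
  qed
  then show ?thesis by (intro exI[of _ n] exI[of _ "\<lambda>m a. a * \<phi> m a"]) blast
qed

text \<open>An enumeration of the index set transfers coordinate families with structured indices,
  here pairs of a resource and a number, to the vectors that the semidefinite program asks
  for.\<close>

lemma vec_realization:
  assumes "finite I"
  shows "\<exists>d (vc :: ('a \<Rightarrow> real) \<Rightarrow> real vec). (\<forall>f. vc f \<in> carrier_vec d) \<and>
           (\<forall>f g. vc f \<bullet> vc g = (\<Sum>t\<in>I. f t * g t))"
proof -
  obtain h where h: "bij_betw h {0..<card I} I"
    using ex_bij_betw_nat_finite[OF assms] by blast
  let ?vc = "\<lambda>f. vec (card I) (\<lambda>n. f (h n)) :: real vec"
  have "?vc f \<bullet> ?vc g = (\<Sum>t\<in>I. f t * g t)" for f g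
    using sum.reindex_bij_betw[OF h, of "\<lambda>t. f t * g t"] by (simp add: scalar_prod_def)
  then show ?thesis by (intro exI[of _ "card I"] exI[of _ ?vc]) simp
qed

section \<open>Weighted costs through symmetric pair interactions\<close>

text \<open>Weighting the costs makes the delay between two players symmetric, which is what allows
  a Gram representation. Infinite ratios become 0 under \<open>enn2real\<close>, so the term
  vanishes for them.\<close>

definition interaction :: "('n, 'e) congestion_game \<Rightarrow> 'e \<Rightarrow> 'n \<Rightarrow> 'n \<Rightarrow> real" where
  "interaction G e j k = weight G j * weight G k *
     (enn2real (smith G e j) * enn2real (smith G e k) /
      (enn2real (smith G e j) + enn2real (smith G e k)))"

lemma enn2real_divide_ennreal:
  assumes "w > 0"
  shows "enn2real (p / ennreal w) = enn2real p / w"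
proof (cases p rule: ennreal_cases)
  case (real r)
  then show ?thesis using assms by (simp add: divide_ennreal)
next
  case top
  then show ?thesis using assms by (simp add: ennreal_top_divide)
qed

lemma smith_less_top:
  assumes "weight G j > 0" "ptime G e j < \<infinity>"
  shows "smith G e j < \<infinity>"
  using assms by (cases "ptime G e j" rule: ennreal_cases) (auto simp: smith_def divide_ennreal)

lemma interaction_nonneg:
  assumes "weight G j \<ge> 0" "weight G k \<ge> 0"
  shows "interaction G e j k \<ge> 0"
  unfolding interaction_def using assms by (intro mult_nonneg_nonneg divide_nonneg_nonneg) auto

lemma interaction_self:
  assumes "weight G j \<ge> 0"
  shows "interaction G e j j = weight G j * enn2real (ptime G e j) / 2"
proof (cases "weight G j = 0")
  case False
  then have "enn2real (smith G e j) = enn2real (ptime G e j) / weight G j"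
    using assms by (simp add: smith_def enn2real_divide_ennreal)
  then have "enn2real (ptime G e j) = weight G j * enn2real (smith G e j)"
    using False by simp
  then show ?thesis by (simp add: interaction_def)
qed (simp add: interaction_def)

text \<open>With positive weights and finite times, p_k = w_k \<delta>_k turns w_j p_k \<delta>_j /
  (\<delta>_j + \<delta>_k) into the symmetric form. If only k has an infinite ratio, k comes last
  and delays j by 0, matching \<open>enn2real \<infinity> = 0\<close>. If both ratios are 0, the
  probability 1/2 multiplies p_k = 0.\<close>

lemma weight_rand_after:
  assumes "weight G j \<ge> 0" "weight G k \<ge> 0" "ptime G e j < \<infinity>"
  shows "weight G j * (rand_after (smith G e j) (smith G e k) * enn2real (ptime G e k))
           = interaction G e j k"
proof (cases "weight G j = 0")
  case False
  with assms have wj: "weight G j > 0" by simp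
  have fj: "smith G e j < \<infinity>" using smith_less_top[OF wj assms(3)] .
  show ?thesis
  proof (cases "weight G k = 0 \<or> ptime G e k = \<infinity>")
    case True
    then have "smith G e k = \<infinity>" using assms(2)
      by (auto simp: smith_def ennreal_top_divide)
    then show ?thesis using fj by (auto simp: rand_after_def interaction_def)
  next
    case False
    with assms have wk: "weight G k > 0" by simp
    have fk: "smith G e k < \<infinity>" using smith_less_top[OF wk] False by (simp add: less_top)
    have pk: "enn2real (ptime G e k) = weight G k * enn2real (smith G e k)"
      using wk by (simp add: smith_def enn2real_divide_ennreal)
    show ?thesis using fj fk unfolding pk
      by (auto simp: rand_after_def interaction_def)
  qed
qed (simp add: interaction_def)

lemma instance_finite_strategies:
  assumes "is_instance G" "j \<in> players G"
  shows "finite (strategies G j)"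
  using assms by (meson finite_Pow_iff finite_subset is_instance_def)

text \<open>Exchanging the sums over strategies and resources collects, at each resource, exactly
  the probabilities that make up the usage.\<close>

lemma sum_strategies_usage:
  assumes "is_instance G" "j \<in> players G"
  shows "(\<Sum>i\<in>strategies G j. x j i * (\<Sum>e\<in>i. c e)) = (\<Sum>e\<in>resources G. usage G x e j * c e)"
proof -
  have fin: "finite (strategies G j)" "finite (resources G)"
    using instance_finite_strategies[OF assms] assms(1) by (simp_all add: is_instance_def)
  have "(\<Sum>e\<in>i. c e) = (\<Sum>e\<in>resources G. if e \<in> i then c e else 0)" if "i \<in> strategies G j" for i
  proof -
    have "i \<subseteq> resources G" using that assms by (auto simp: is_instance_def)
    then show ?thesis using fin by (simp add: sum.inter_restrict[symmetric] Int_absorb1)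
  qed
  then have "(\<Sum>i\<in>strategies G j. x j i * (\<Sum>e\<in>i. c e))
      = (\<Sum>i\<in>strategies G j. \<Sum>e\<in>resources G. if e \<in> i then x j i * c e else 0)"
    by (auto simp: sum_distrib_left intro!: sum.cong)
  also have "\<dots> = (\<Sum>e\<in>resources G. \<Sum>i\<in>strategies G j. if e \<in> i then x j i * c e else 0)"
    by (rule sum.swap)
  also have "\<dots> = (\<Sum>e\<in>resources G. usage G x e j * c e)"
    unfolding usage_def sum.inter_filter[OF fin(1)] sum_distrib_right
    by (intro sum.cong refl) simp
  finally show ?thesis .
qed

lemma weight_resource_cost:
  assumes "is_instance G" "j \<in> players G" "ptime G e j < \<infinity>"
  shows "weight G j * (enn2real (ptime G e j) + (\<Sum>k\<in>players G - {j}.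
            rand_after (smith G e j) (smith G e k) * enn2real (ptime G e k) * usage G x e k))
       = weight G j * enn2real (ptime G e j)
           + (\<Sum>k\<in>players G - {j}. interaction G e j k * usage G x e k)"
proof -
  have "weight G j *
        (rand_after (smith G e j) (smith G e k) * enn2real (ptime G e k) * usage G x e k)
      = interaction G e j k * usage G x e k" if "k \<in> players G - {j}" for k
    using weight_rand_after[of G j k e] assms that by (auto simp: is_instance_def mult.assoc)
  then show ?thesis unfolding distrib_left sum_distrib_left
    by (intro arg_cong2[where f = "(+)"] refl sum.cong)
qed

lemma weight_player_cost:
  assumes "is_instance G" "j \<in> players G"
  shows "weight G j * player_cost G x j = (\<Sum>i\<in>strategies G j. x j i *
      (\<Sum>e\<in>i. weight G j * enn2real (ptime G e j)
                + (\<Sum>k\<in>players G - {j}. interaction G e j k * usage G x e k)))"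
proof -
  have "\<And>i e. i \<in> strategies G j \<Longrightarrow> e \<in> i \<Longrightarrow> ptime G e j < \<infinity>"
    using assms by (auto simp: is_instance_def)
  then show ?thesis
    unfolding player_cost_def sum_distrib_left mult.left_commute[of "weight G j"]
    by (intro sum.cong refl arg_cong2[where f = "(*)"])
       (simp add: weight_resource_cost[OF assms, symmetric] sum_distrib_left)
qed

text \<open>The inner sum involves only the usage of the other players, which a deviation of j
  leaves unchanged; the point mass then selects the bracket of strategy i.\<close>

lemma weight_player_cost_deviate:
  assumes "is_instance G" "j \<in> players G" "i \<in> strategies G j"
  shows "weight G j * player_cost G (deviate x j i) j =
      (\<Sum>e\<in>i. weight G j * enn2real (ptime G e j)
                + (\<Sum>k\<in>players G - {j}. interaction G e j k * usage G x e k))"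
proof -
  have "usage G (deviate x j i) e k = usage G x e k" if "k \<noteq> j" for e k
    using that by (simp add: usage_def deviate_def)
  moreover have "(\<Sum>i'\<in>strategies G j. deviate x j i j i' * f i') = f i" for f :: "_ \<Rightarrow> real"
    using instance_finite_strategies[OF assms(1,2)] assms(3)
    by (simp add: deviate_def if_distrib[of "\<lambda>u. u * _"] sum.delta' cong: if_cong)
  ultimately show ?thesis
    unfolding weight_player_cost[OF assms(1,2)] by simp
qed

lemma social_cost_usage:
  assumes "is_instance G"
  shows "social_cost G x = (\<Sum>e\<in>resources G. \<Sum>j\<in>players G. usage G x e j *
      (weight G j * enn2real (ptime G e j)
        + (\<Sum>k\<in>players G - {j}. interaction G e j k * usage G x e k)))"
  unfolding social_cost_def
  by (subst sum.swap, intro sum.cong refl)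
     (simp add: weight_player_cost[OF assms] sum_strategies_usage[OF assms])

lemma usage_bounds:
  assumes "is_instance G" "assignment G x" "j \<in> players G"
  shows "0 \<le> usage G x e j" "usage G x e j \<le> 1"
proof -
  have nonneg: "\<And>i. i \<in> strategies G j \<Longrightarrow> x j i \<ge> 0" and one: "(\<Sum>i\<in>strategies G j. x j i) = 1"
    using assms by (auto simp: assignment_def)
  show "0 \<le> usage G x e j" unfolding usage_def using nonneg by (intro sum_nonneg) auto
  have "usage G x e j \<le> (\<Sum>i\<in>strategies G j. x j i)" unfolding usage_def
    using instance_finite_strategies assms nonneg by (intro sum_mono2) auto
  then show "usage G x e j \<le> 1" using one by simp
qed

text \<open>This is the bound on the squared norm of U. Off the diagonal the two sides agree; on it,
  with P the weighted processing time, z_j^2 P / 2 is compared with z_j P, and z_j lies between 0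
  and 1.\<close>

lemma interaction_usage_le_social_cost:
  assumes "is_instance G" "assignment G x"
  shows "(\<Sum>e\<in>resources G. \<Sum>j\<in>players G. \<Sum>k\<in>players G.
            usage G x e j * usage G x e k * interaction G e j k) \<le> social_cost G x"
  unfolding social_cost_usage[OF assms(1)]
proof (intro sum_mono)
  fix e j assume "e \<in> resources G" and j: "j \<in> players G"
  have fin: "finite (players G)" and w: "weight G j \<ge> 0" using assms j by (auto simp: is_instance_def)
  let ?z = "usage G x e" and ?P = "weight G j * enn2real (ptime G e j)"
  have z: "0 \<le> ?z j" "?z j \<le> 1" using usage_bounds[OF assms j] by auto
  have "?z j * ?z j * interaction G e j j \<le> ?z j * ?P"
  proof -
    have "?z j * (?z j * (?P / 2)) \<le> ?z j * (1 * ?P)"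
      using z w by (intro mult_left_mono mult_mono) auto
    then show ?thesis using w by (simp add: interaction_self mult.assoc)
  qed
  moreover have "(\<Sum>k\<in>players G. ?z j * ?z k * interaction G e j k)
      = ?z j * ?z j * interaction G e j j + ?z j * (\<Sum>k\<in>players G - {j}. interaction G e j k * ?z k)"
    unfolding sum.remove[OF fin j] by (simp add: sum_distrib_left mult.commute mult.left_commute)
  ultimately show "(\<Sum>k\<in>players G. ?z j * ?z k * interaction G e j k)
      \<le> ?z j * (?P + (\<Sum>k\<in>players G - {j}. interaction G e j k * ?z k))"
    by (simp add: distrib_left)
qed

section \<open>A feasible solution from an equilibrium\<close>

text \<open>The kernel is factorized once on the finite set of all ratios of all resources, so one n
  serves every resource; the weights are absorbed into the coordinates.\<close>

lemma interaction_gram: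
  fixes G :: "('n, 'e) congestion_game"
  assumes "is_instance G"
  shows "\<exists>n (\<psi> :: nat \<Rightarrow> 'e \<Rightarrow> 'n \<Rightarrow> real). \<forall>e\<in>resources G. \<forall>j\<in>players G. \<forall>k\<in>players G.
    (\<Sum>m<n. \<psi> m e j * \<psi> m e k) = interaction G e j k"
proof -
  let ?A = "(\<lambda>(e, j). enn2real (smith G e j)) ` (resources G \<times> players G)"
  have "finite ?A" "\<forall>a\<in>?A. a \<ge> 0" using assms by (auto simp: is_instance_def)
  then obtain n and \<phi> :: "nat \<Rightarrow> real \<Rightarrow> real" where \<phi>:
    "\<And>a b. a \<in> ?A \<Longrightarrow> b \<in> ?A \<Longrightarrow> (\<Sum>m<n. \<phi> m a * \<phi> m b) = a * b / (a + b)"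
    using parallel_sum_kernel_gram[of ?A] by blast
  let ?\<psi> = "\<lambda>m e j. weight G j * \<phi> m (enn2real (smith G e j))"
  have "(\<Sum>m<n. ?\<psi> m e j * ?\<psi> m e k) = interaction G e j k"
    if "e \<in> resources G" "j \<in> players G" "k \<in> players G" for e j k
  proof -
    let ?a = "enn2real (smith G e j)" and ?b = "enn2real (smith G e k)"
    have "?a \<in> ?A" "?b \<in> ?A" using that by auto
    from \<phi>[OF this] show ?thesis unfolding interaction_def
      by (simp add: sum_distrib_left[symmetric] mult.assoc mult.left_commute)
  qed
  then show ?thesis by (intro exI[of _ n] exI[of _ ?\<psi>]) blast
qed

lemma nash_sdp_solution:
  fixes G :: "('n, 'e) congestion_game"
  assumes G: "is_instance G" and x: "nash_equilibrium G x"
  shows "\<exists>d y v0 v. sdp_feasible G d y v0 v \<and> sdp_objective G y v0 \<ge> social_cost G x / 2"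
proof -
  have asg: "assignment G x" using x by (simp add: nash_equilibrium_def)
  have fin: "finite (players G)" "finite (resources G)" using G by (auto simp: is_instance_def)
  have w: "\<And>j. j \<in> players G \<Longrightarrow> weight G j \<ge> 0" using G by (auto simp: is_instance_def)
  have sub: "\<And>j i. j \<in> players G \<Longrightarrow> i \<in> strategies G j \<Longrightarrow> i \<subseteq> resources G"
    using G by (auto simp: is_instance_def)
  obtain n and \<psi> :: "nat \<Rightarrow> 'e \<Rightarrow> 'n \<Rightarrow> real" where
    \<psi>: "\<And>e j k. e \<in> resources G \<Longrightarrow> j \<in> players G \<Longrightarrow> k \<in> players G \<Longrightarrow>
      (\<Sum>m<n. \<psi> m e j * \<psi> m e k) = interaction G e j k"
    using interaction_gram[OF G] by blast
  \<comment> \<open>Each resource gets its own block of n coordinates, so different resources are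
    orthogonal and scalar products add up over resources.\<close>
  let ?I = "resources G \<times> {..<n}"
  obtain d and vc :: "('e \<times> nat \<Rightarrow> real) \<Rightarrow> real vec" where
    vc: "\<And>f. vc f \<in> carrier_vec d" "\<And>f g. vc f \<bullet> vc g = (\<Sum>t\<in>?I. f t * g t)"
    using vec_realization[of ?I] fin by auto
  \<comment> \<open>Every vector used below is a combination of the Gram vectors with coefficients
    depending on resource and player, so this one bilinear formula yields all scalar
    products.\<close>
  have ip: "vc (\<lambda>(e, m). \<Sum>j\<in>players G. a e j * \<psi> m e j) \<bullet> vc (\<lambda>(e, m). \<Sum>k\<in>players G. b e k * \<psi> m e k)
      = (\<Sum>e\<in>resources G. \<Sum>j\<in>players G. \<Sum>k\<in>players G. a e j * b e k * interaction G e j k)" for a b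
  proof -
    have "(\<Sum>m<n. (\<Sum>j\<in>players G. a e j * \<psi> m e j) * (\<Sum>k\<in>players G. b e k * \<psi> m e k))
        = (\<Sum>j\<in>players G. \<Sum>k\<in>players G. a e j * b e k * interaction G e j k)"
      if e: "e \<in> resources G" for e
    proof -
      have "(\<Sum>m<n. (\<Sum>j\<in>players G. a e j * \<psi> m e j) * (\<Sum>k\<in>players G. b e k * \<psi> m e k))
          = (\<Sum>m<n. \<Sum>j\<in>players G. \<Sum>k\<in>players G. a e j * b e k * (\<psi> m e j * \<psi> m e k))"
        by (simp add: sum_product algebra_simps)
      also have "\<dots> = (\<Sum>j\<in>players G. \<Sum>m<n. \<Sum>k\<in>players G. a e j * b e k * (\<psi> m e j * \<psi> m e k))"
        by (rule sum.swap)
      also have "\<dots> = (\<Sum>j\<in>players G. \<Sum>k\<in>players G. \<Sum>m<n. a e j * b e k * (\<psi> m e j * \<psi> m e k))"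
        by (intro sum.cong refl sum.swap)
      also have "\<dots> = (\<Sum>j\<in>players G. \<Sum>k\<in>players G. a e j * b e k * interaction G e j k)"
        using \<psi>[OF e] by (simp add: sum_distrib_left[symmetric])
      finally show ?thesis .
    qed
    then show ?thesis
      unfolding vc(2) by (simp add: sum.cartesian_product')
  qed
  define z where "z = usage G x"
  define P where "P j i = (\<Sum>e\<in>i. weight G j * enn2real (ptime G e j))" for j i
  \<comment> \<open>Let P be the weighted processing time of i and S its interaction with the usage
    of all players. For v_ij = \<alpha> u_ij and v_0 = \<beta> U the first constraint has right-hand
    side (1 - \<alpha>^2 / 4) P + \<alpha> \<beta> S. Equating both coefficients with the scale c of
    y_j, the guaranteed fraction c - \<beta>^2 / 2 of C(x) is largest at \<alpha>^2 = 4/3, where c =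
    2/3 and \<beta>^2 = 1/3.\<close>
  define \<alpha> where "\<alpha> = (2 / sqrt 3 :: real)"
  define \<beta> where "\<beta> = (1 / sqrt 3 :: real)"
  have \<alpha>\<beta>: "\<alpha> * \<alpha> = 4 / 3" "\<beta> * \<alpha> = 2 / 3" "\<beta> * \<beta> = 1 / 3"
    by (simp_all add: \<alpha>_def \<beta>_def)
  define ind where "ind j i e k = (if k = j \<and> e \<in> i then \<alpha> else 0)" for j :: 'n and i and e :: 'e and k
  define v where "v j i = vc (\<lambda>(e, m). \<Sum>k\<in>players G. ind j i e k * \<psi> m e k)" for j i
  define v0 where "v0 = vc (\<lambda>(e, m). \<Sum>k\<in>players G. \<beta> * z e k * \<psi> m e k)"
  define y where "y j = 2 / 3 * (weight G j * player_cost G x j)" for j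
  have vv: "v j i \<bullet> v k i' = 4 / 3 * (\<Sum>e\<in>i \<inter> i'. interaction G e j k)"
    if "j \<in> players G" "k \<in> players G" "i \<in> strategies G j" "i' \<in> strategies G k" for i j i' k
  proof -
    have "v j i \<bullet> v k i' = (\<Sum>e\<in>resources G. \<Sum>j'\<in>players G. \<Sum>k'\<in>players G.
        ind j i e j' * ind k i' e k' * interaction G e j' k')"
      unfolding v_def by (rule ip)
    also have "\<dots> = (\<Sum>e\<in>resources G. if e \<in> i \<inter> i' then \<alpha> * \<alpha> * interaction G e j k else 0)"
    proof (rule sum.cong[OF refl])
      fix e
      have "(\<Sum>j'\<in>players G. \<Sum>k'\<in>players G. ind j i e j' * ind k i' e k' * interaction G e j' k')
        = (\<Sum>j'\<in>players G. if j' = j then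
             (\<Sum>k'\<in>players G. if k' = k then ind j i e j * ind k i' e k * interaction G e j k else 0) else 0)"
        by (intro sum.cong refl) (auto simp: ind_def intro!: sum.cong sum.neutral)
      then show "(\<Sum>j'\<in>players G. \<Sum>k'\<in>players G. ind j i e j' * ind k i' e k' * interaction G e j' k')
        = (if e \<in> i \<inter> i' then \<alpha> * \<alpha> * interaction G e j k else 0)"
        using that fin by (simp add: sum.delta ind_def)
    qed
    also have "\<dots> = (\<Sum>e\<in>i \<inter> i'. \<alpha> * \<alpha> * interaction G e j k)"
    proof -
      have "i \<inter> i' \<subseteq> resources G" using sub that by blast
      then show ?thesis using fin by (simp only: sum.inter_restrict[symmetric] Int_absorb1)
    qed
    finally show ?thesis by (simp add: \<alpha>\<beta> sum_distrib_left)
  qed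
  have v0v: "v0 \<bullet> v j i = 2 / 3 * (\<Sum>e\<in>i. \<Sum>k\<in>players G. interaction G e j k * z e k)"
    if "j \<in> players G" "i \<in> strategies G j" for j i
  proof -
    have "v0 \<bullet> v j i = (\<Sum>e\<in>resources G. \<Sum>k\<in>players G. \<Sum>j'\<in>players G.
        \<beta> * z e k * ind j i e j' * interaction G e k j')"
      unfolding v_def v0_def by (rule ip)
    also have "\<dots> = (\<Sum>e\<in>resources G. if e \<in> i then
        2 / 3 * (\<Sum>k\<in>players G. interaction G e j k * z e k) else 0)"
    proof (rule sum.cong[OF refl])
      fix e
      have "(\<Sum>j'\<in>players G. \<beta> * z e k * ind j i e j' * interaction G e k j')
        = (if e \<in> i then 2 / 3 * (interaction G e j k * z e k) else 0)" for k
      proof -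
        have "(\<Sum>j'\<in>players G. \<beta> * z e k * ind j i e j' * interaction G e k j')
          = (\<Sum>j'\<in>players G. if j' = j then \<beta> * z e k * ind j i e j * interaction G e k j else 0)"
          by (intro sum.cong refl) (auto simp: ind_def)
        also have "\<dots> = \<beta> * z e k * ind j i e j * interaction G e k j"
          using that fin by (simp add: sum.delta)
        also have "\<dots> = (if e \<in> i then (\<beta> * \<alpha>) * (interaction G e j k * z e k) else 0)"
          by (simp add: ind_def interaction_def ac_simps)
        finally show ?thesis by (simp add: \<alpha>\<beta>)
      qed
      then show "(\<Sum>k\<in>players G. \<Sum>j'\<in>players G. \<beta> * z e k * ind j i e j' * interaction G e k j')
        = (if e \<in> i then 2 / 3 * (\<Sum>k\<in>players G. interaction G e j k * z e k) else 0)"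
        by (simp add: sum_distrib_left)
    qed
    also have "\<dots> = (\<Sum>e\<in>i. 2 / 3 * (\<Sum>k\<in>players G. interaction G e j k * z e k))"
      using sub[OF that] fin by (simp only: sum.inter_restrict[symmetric] Int_absorb1)
    finally show ?thesis by (simp add: sum_distrib_left)
  qed
  have v0v0: "v0 \<bullet> v0 \<le> social_cost G x / 3"
  proof -
    have "v0 \<bullet> v0 = (\<Sum>e\<in>resources G. \<Sum>j\<in>players G. \<Sum>k\<in>players G.
        \<beta> * z e j * (\<beta> * z e k) * interaction G e j k)"
      unfolding v0_def by (rule ip)
    also have "\<dots> = \<beta> * \<beta> * (\<Sum>e\<in>resources G. \<Sum>j\<in>players G. \<Sum>k\<in>players G.
        z e j * z e k * interaction G e j k)"
      by (simp add: sum_distrib_left ac_simps)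
    finally show ?thesis
      using interaction_usage_le_social_cost[OF G asg] by (simp add: \<alpha>\<beta> z_def)
  qed
  have "y j \<le> P j i - (v j i \<bullet> v j i) / 2 + v0 \<bullet> v j i"
    if j: "j \<in> players G" and i: "i \<in> strategies G j" for j i
  proof -
    have "(\<Sum>e\<in>i. interaction G e j j) = P j i / 2"
      using w[OF j] by (simp add: interaction_self P_def sum_divide_distrib)
    then have vji: "v j i \<bullet> v j i = 2 / 3 * P j i" using vv[OF j j i i] by simp
    have "player_cost G x j \<le> player_cost G (deviate x j i) j"
      using x i j by (auto simp: nash_equilibrium_def)
    then have "weight G j * player_cost G x j \<le> weight G j * player_cost G (deviate x j i) j"
      using w[OF j] by (rule mult_left_mono)
    also have "\<dots> = P j i + (\<Sum>e\<in>i. \<Sum>k\<in>players G - {j}. interaction G e j k * z e k)"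
      by (simp add: weight_player_cost_deviate[OF G j i] P_def z_def sum.distrib)
    \<comment> \<open>The vector \<open>v0\<close> also contains the share of j itself, whereas j's
      cost omits k = j; the added term is nonnegative. Two thirds of the resulting bound is exactly
      the right-hand side of the constraint.\<close>
    also have "\<dots> \<le> P j i + (\<Sum>e\<in>i. \<Sum>k\<in>players G. interaction G e j k * z e k)"
      unfolding z_def using fin w j usage_bounds[OF G asg]
      by (intro add_left_mono sum_mono sum_mono2) (auto intro!: mult_nonneg_nonneg interaction_nonneg)
    finally show ?thesis by (simp add: y_def vji v0v[OF j i])
  qed
  \<comment> \<open>The factor \<alpha>^2 = 4/3 stays below the permitted 2, and interactions are
    nonnegative.\<close>
  moreover have "v j i \<bullet> v k i' \<le> 2 * (\<Sum>e\<in>i \<inter> i'. interaction G e j k)"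
    if "j \<in> players G" "k \<in> players G" "i \<in> strategies G j" "i' \<in> strategies G k" for j k i i'
    unfolding vv[OF that] using w that
    by (intro mult_right_mono sum_nonneg interaction_nonneg) auto
  ultimately have "sdp_feasible G d y v0 v"
    unfolding sdp_feasible_def P_def interaction_def using vc(1) by (auto simp: v_def v0_def)
  moreover have "(\<Sum>j\<in>players G. y j) = 2 / 3 * social_cost G x"
    unfolding y_def social_cost_def by (rule sum_distrib_left[symmetric])
  then have "sdp_objective G y v0 \<ge> social_cost G x / 2"
    using v0v0 by (simp add: sdp_objective_def)
  ultimately show ?thesis by blast
qed

section \<open>Weak duality against pure assignments\<close>

lemma pure_assignment_choice:
  assumes "is_instance G" "pure_assignment G x"
  obtains s where "\<And>j. j \<in> players G \<Longrightarrow> s j \<in> strategies G j"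
    "\<And>j i. j \<in> players G \<Longrightarrow> i \<in> strategies G j \<Longrightarrow> x j i = (if i = s j then 1 else 0)"
proof -
  have "\<exists>i\<in>strategies G j. \<forall>i'\<in>strategies G j. x j i' = (if i' = i then 1 else 0)"
    if j: "j \<in> players G" for j
  proof -
    have fin: "finite (strategies G j)" by (rule instance_finite_strategies[OF assms(1) j])
    have v01: "\<And>i. i \<in> strategies G j \<Longrightarrow> x j i \<in> {0, 1}" and one: "(\<Sum>i\<in>strategies G j. x j i) = 1"
      using assms j by (auto simp: pure_assignment_def assignment_def)
    obtain i where i: "i \<in> strategies G j" "x j i = 1"
      using one v01 by (metis insertE singletonD sum.neutral zero_neq_one)
    have "(\<Sum>i'\<in>strategies G j - {i}. x j i') = 0" using one sum.remove[OF fin i(1), of "x j"] i by simp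
    moreover have "\<And>i'. i' \<in> strategies G j - {i} \<Longrightarrow> x j i' \<ge> 0" using v01 by force
    ultimately have "\<forall>i'\<in>strategies G j - {i}. x j i' = 0"
      using fin by (subst (asm) sum_nonneg_eq_0_iff) auto
    then show ?thesis using i by auto
  qed
  then show ?thesis using that by metis
qed

text \<open>In this form the pair terms are the right-hand sides of the pairwise constraints without
  their factor 2, summed over ordered pairs.\<close>

lemma social_cost_pure:
  assumes G: "is_instance G"
    and s: "\<And>j. j \<in> players G \<Longrightarrow> s j \<in> strategies G j"
    and x: "\<And>j i. j \<in> players G \<Longrightarrow> i \<in> strategies G j \<Longrightarrow> x j i = (if i = s j then 1 else 0)"
  shows "social_cost G x = (\<Sum>j\<in>players G. (\<Sum>e\<in>s j. weight G j * enn2real (ptime G e j))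
           + (\<Sum>k\<in>players G - {j}. \<Sum>e\<in>s j \<inter> s k. interaction G e j k))"
  unfolding social_cost_def
proof (rule sum.cong[OF refl])
  fix j assume j: "j \<in> players G"
  have usage: "usage G x e k = (if e \<in> s k then 1 else 0)" if "k \<in> players G" for e k
  proof -
    have "usage G x e k = (\<Sum>i\<in>{i\<in>strategies G k. e \<in> i}. if i = s k then 1 else 0)"
      unfolding usage_def using x that by (intro sum.cong) auto
    also have "\<dots> = (if e \<in> s k then 1 else 0)"
      using instance_finite_strategies[OF G that] s[OF that] by (simp add: sum.delta)
    finally show ?thesis .
  qed
  have finj: "finite (s j)" using s[OF j] G j
    by (meson Pow_iff finite_subset is_instance_def subsetD)
  let ?f = "\<lambda>i. \<Sum>e\<in>i. weight G j * enn2real (ptime G e j)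
                + (\<Sum>k\<in>players G - {j}. interaction G e j k * usage G x e k)"
  have "weight G j * player_cost G x j = (\<Sum>i\<in>strategies G j. if i = s j then ?f i else 0)"
    unfolding weight_player_cost[OF G j] by (intro sum.cong refl) (simp add: x[OF j])
  also have "\<dots> = ?f (s j)"
    using instance_finite_strategies[OF G j] s[OF j] by (simp add: sum.delta)
  also have "\<dots> = (\<Sum>e\<in>s j. weight G j * enn2real (ptime G e j))
      + (\<Sum>k\<in>players G - {j}. \<Sum>e\<in>s j. if e \<in> s k then interaction G e j k else 0)"
    unfolding sum.distrib by (subst sum.swap) (simp add: usage if_distrib cong: if_cong)
  also have "(\<Sum>k\<in>players G - {j}. \<Sum>e\<in>s j. if e \<in> s k then interaction G e j k else 0)
      = (\<Sum>k\<in>players G - {j}. \<Sum>e\<in>s j \<inter> s k. interaction G e j k)"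
    using finj by (simp only: sum.inter_restrict)
  finally show "weight G j * player_cost G x j = (\<Sum>e\<in>s j. weight G j * enn2real (ptime G e j))
      + (\<Sum>k\<in>players G - {j}. \<Sum>e\<in>s j \<inter> s k. interaction G e j k)" .
qed

text \<open>The squared norm of v_0 minus the sum of the u_j is nonnegative. The computation is
  coordinatewise, with \<open>S\<close> holding the coordinates of that sum.\<close>

lemma sum_scalar_prod_complete_square:
  fixes v0 :: "real vec"
  assumes "finite J" "v0 \<in> carrier_vec d" "\<And>j. j \<in> J \<Longrightarrow> u j \<in> carrier_vec d"
  shows "2 * (\<Sum>j\<in>J. v0 \<bullet> u j) - v0 \<bullet> v0 \<le> (\<Sum>j\<in>J. \<Sum>k\<in>J. u j \<bullet> u k)"
proof -
  have dim: "dim_vec (u j) = d" if "j \<in> J" for j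
    using assms(3)[OF that] by simp
  define S where "S t = (\<Sum>j\<in>J. u j $ t)" for t
  have "(\<Sum>j\<in>J. v0 \<bullet> u j) = (\<Sum>j\<in>J. \<Sum>t\<in>{0..<d}. v0 $ t * u j $ t)"
    using dim by (simp add: scalar_prod_def)
  also have "\<dots> = (\<Sum>t\<in>{0..<d}. v0 $ t * S t)"
    by (subst sum.swap) (simp add: S_def sum_distrib_left)
  finally have cross: "(\<Sum>j\<in>J. v0 \<bullet> u j) = (\<Sum>t\<in>{0..<d}. v0 $ t * S t)" .
  have "(\<Sum>j\<in>J. \<Sum>k\<in>J. u j \<bullet> u k) = (\<Sum>j\<in>J. \<Sum>k\<in>J. \<Sum>t\<in>{0..<d}. u j $ t * u k $ t)"
    using dim by (simp add: scalar_prod_def)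
  also have "\<dots> = (\<Sum>j\<in>J. \<Sum>t\<in>{0..<d}. \<Sum>k\<in>J. u j $ t * u k $ t)"
    by (intro sum.cong refl sum.swap)
  also have "\<dots> = (\<Sum>t\<in>{0..<d}. S t * S t)"
    by (subst sum.swap) (simp add: S_def sum_product)
  finally have square: "(\<Sum>j\<in>J. \<Sum>k\<in>J. u j \<bullet> u k) = (\<Sum>t\<in>{0..<d}. S t * S t)" .
  have "0 \<le> (\<Sum>t\<in>{0..<d}. (v0 $ t - S t) * (v0 $ t - S t))"
    by (intro sum_nonneg) simp
  also have "\<dots> = v0 \<bullet> v0 - 2 * (\<Sum>t\<in>{0..<d}. v0 $ t * S t) + (\<Sum>t\<in>{0..<d}. S t * S t)"
    using assms(2)
    by (simp add: scalar_prod_def algebra_simps sum.distrib sum_subtractf sum_distrib_left)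
  finally show ?thesis using cross square by simp
qed

text \<open>Only the vectors of the chosen strategies matter. Completing the square leaves half of
  the double sum of their scalar products. Its diagonal cancels the terms -|u_j|^2 / 2 from the
  bounds on y_j, and off the diagonal the half cancels the factor 2 of the pairwise
  constraints.\<close>

lemma sdp_weak_duality:
  assumes G: "is_instance G" and feas: "sdp_feasible G d y v0 v" and pure: "pure_assignment G x"
  shows "sdp_objective G y v0 \<le> social_cost G x"
proof -
  obtain s where s: "\<And>j. j \<in> players G \<Longrightarrow> s j \<in> strategies G j"
    and x: "\<And>j i. j \<in> players G \<Longrightarrow> i \<in> strategies G j \<Longrightarrow> x j i = (if i = s j then 1 else 0)"
    using pure_assignment_choice[OF G pure] by blast
  have fin: "finite (players G)" using G by (simp add: is_instance_def)
  define u where "u j = v j (s j)" for j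
  define P where "P j = (\<Sum>e\<in>s j. weight G j * enn2real (ptime G e j))" for j
  have y: "y j \<le> P j - (u j \<bullet> u j) / 2 + v0 \<bullet> u j" if "j \<in> players G" for j
    using feas s[OF that] that by (auto simp: sdp_feasible_def P_def u_def)
  have uu: "u j \<bullet> u k \<le> 2 * (\<Sum>e\<in>s j \<inter> s k. interaction G e j k)"
    if "j \<in> players G" "k \<in> players G - {j}" for j k
  proof -
    have "(s j, j) \<noteq> (s k, k)" "k \<in> players G" using that by auto
    then show ?thesis
      using feas s[of j] s[of k] that(1) unfolding sdp_feasible_def interaction_def u_def by blast
  qed
  have "(\<Sum>j\<in>players G. \<Sum>k\<in>players G. u j \<bullet> u k)
      = (\<Sum>j\<in>players G. u j \<bullet> u j + (\<Sum>k\<in>players G - {j}. u j \<bullet> u k))"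
    by (intro sum.cong refl sum.remove fin)
  also have "\<dots> \<le> (\<Sum>j\<in>players G. u j \<bullet> u j
      + (\<Sum>k\<in>players G - {j}. 2 * (\<Sum>e\<in>s j \<inter> s k. interaction G e j k)))"
    by (intro sum_mono add_left_mono uu)
  also have "\<dots> = (\<Sum>j\<in>players G. u j \<bullet> u j)
      + 2 * (\<Sum>j\<in>players G. \<Sum>k\<in>players G - {j}. \<Sum>e\<in>s j \<inter> s k. interaction G e j k)"
    by (simp add: sum.distrib sum_distrib_left)
  finally have pairs: "(\<Sum>j\<in>players G. \<Sum>k\<in>players G. u j \<bullet> u k) \<le> \<dots>" .
  have "2 * (\<Sum>j\<in>players G. v0 \<bullet> u j) - v0 \<bullet> v0 \<le> (\<Sum>j\<in>players G. \<Sum>k\<in>players G. u j \<bullet> u k)"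
    using feas s by (intro sum_scalar_prod_complete_square fin) (auto simp: sdp_feasible_def u_def)
  moreover have "(\<Sum>j\<in>players G. y j) \<le> (\<Sum>j\<in>players G. P j - (u j \<bullet> u j) / 2 + v0 \<bullet> u j)"
    by (intro sum_mono y)
  moreover have "\<dots> = (\<Sum>j\<in>players G. P j) - (\<Sum>j\<in>players G. u j \<bullet> u j) / 2 + (\<Sum>j\<in>players G. v0 \<bullet> u j)"
    by (simp add: sum.distrib sum_subtractf sum_divide_distrib)
  ultimately show ?thesis using pairs
    by (simp add: sdp_objective_def social_cost_pure[OF G s x] P_def sum.distrib)
qed

section \<open>The price of anarchy\<close>

lemma nash_le_twice_pure:
  assumes "is_instance G" "nash_equilibrium G x" "pure_assignment G x'"
  shows "social_cost G x \<le> 2 * social_cost G x'"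
proof -
  obtain d y v0 v where "sdp_feasible G d y v0 v" "sdp_objective G y v0 \<ge> social_cost G x / 2"
    using nash_sdp_solution[OF assms(1,2)] by blast
  with sdp_weak_duality[OF assms(1) _ assms(3)] show ?thesis by fastforce
qed

lemma price_of_anarchy_le:
  assumes "is_instance G"
  shows "price_of_anarchy G \<le> 2"
  unfolding price_of_anarchy_def
proof (rule SUP_least)
  fix x assume "x \<in> {x. nash_equilibrium G x}"
  then have x: "nash_equilibrium G x" by simp
  let ?m = "INF x'\<in>{x'. pure_assignment G x'}. ennreal (social_cost G x')"
  have "ennreal (social_cost G x / 2) \<le> ?m"
    using nash_le_twice_pure[OF assms x] by (intro INF_greatest ennreal_leI) fastforce
  then have "2 * ennreal (social_cost G x / 2) \<le> 2 * ?m"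
    by (rule mult_left_mono) simp
  then have le: "ennreal (social_cost G x) \<le> 2 * ?m"
    by (simp add: ennreal_mult'[symmetric] flip: ennreal_numeral)
  show "ennreal (social_cost G x) / ?m \<le> 2"
  \<comment> \<open>If the infimum is 0, then \<open>le\<close> forces the equilibrium cost to be 0
    in \<open>ennreal\<close>, and the ratio is \<open>0 / 0 = 0\<close>.\<close>
  proof (cases "?m = 0")
    case True
    then show ?thesis using le by simp
  next
    case False
    then show ?thesis using le by (simp add: divide_le_posI_ennreal mult.commute zero_less_iff_neq_zero)
  qed
qed

theorem theorem4p10:
  fixes G :: "('n, 'e) congestion_game"
  assumes "is_instance G"
  shows "(\<forall>x. nash_equilibrium G x \<longrightarrow>
            (\<exists>d y v0 v. sdp_feasible G d y v0 v \<and> sdp_objective G y v0 \<ge> social_cost G x / 2))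
       \<and> price_of_anarchy G \<le> 2
       \<and> (\<forall>x x'. nash_equilibrium G x \<and> pure_assignment G x' \<longrightarrow>
            social_cost G x \<le> 2 * social_cost G x')"
  using nash_sdp_solution[OF assms] price_of_anarchy_le[OF assms] nash_le_twice_pure[OF assms]
  by blast

end
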